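(* Let $f\in F(n)$ be a derangement (a permutation of $\{0,1\}^n$ with no fixed point). Then there exists $h\in F(n)$ with $h\sim f$ such that, for all $x,y\in\{0,1\}^n$, $\mathcal{A}(h)$ has a path from $x$ to $y$ of length at most $d(x,y)+4$.
   Context: $F(n)$ is the set of all functions $f:\{0,1\}^n\to\{0,1\}^n$, written $f=(f_1,\dots,f_n)$. $e_i$ is the configuration with a $1$ exactly in component $i$; addition is componentwise modulo $2$. The asynchronous graph $\mathcal{A}(f)$ is the digraph on $\{0,1\}^n$ with an arc from $x$ to $x+e_i$ whenever $f_i(x)\neq x_i$. $d(x,y)$ is the Hamming distance (number of components where $x$ and $y$ differ). $\mathcal{S}(f)$ has an arc $x\to f(x)$; $f\sim h$ means $\mathcal{S}(f)$ and $\mathcal{S}(h)$ are isomorphic. *)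

theory Defs
  imports "HOL-Library.FuncSet" "Graph_Theory.Graph_Theory"
begin

(* Components are indexed by 0, ..., n - 1; True stands for 1 and False for 0. *)
definition configs :: "nat \<Rightarrow> bool list set" where
  "configs n = {x. length x = n}"

(* Values outside configs n are unconstrained; the graphs below do not depend on them. *)
definition F :: "nat \<Rightarrow> (bool list \<Rightarrow> bool list) set" where
  "F n = configs n \<rightarrow> configs n"

(* Addition modulo 2 is exclusive or, which on bool is disequality. *)
definition add_config :: "bool list \<Rightarrow> bool list \<Rightarrow> bool list" (infixl "\<oplus>\<^sub>2" 65) where
  "x \<oplus>\<^sub>2 y = map2 (\<lambda>a b. a \<noteq> b) x y"

definition unit_config :: "nat \<Rightarrow> nat \<Rightarrow> bool list" where
  "unit_config n i = map (\<lambda>j. j = i) [0..<n]"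

definition hamming_dist :: "bool list \<Rightarrow> bool list \<Rightarrow> nat" where
  "hamming_dist x y = card {i. i < length x \<and> x ! i \<noteq> y ! i}"

definition async_graph :: "nat \<Rightarrow> (bool list \<Rightarrow> bool list) \<Rightarrow> bool list pair_pre_digraph" where
  "async_graph n f =
    \<lparr> pverts = configs n,
      parcs = {(x, x \<oplus>\<^sub>2 unit_config n i) | x i. x \<in> configs n \<and> i < n \<and> f x ! i \<noteq> x ! i} \<rparr>"

definition sync_graph :: "nat \<Rightarrow> (bool list \<Rightarrow> bool list) \<Rightarrow> bool list pair_pre_digraph" where
  "sync_graph n f = \<lparr> pverts = configs n, parcs = {(x, f x) | x. x \<in> configs n} \<rparr>"

definition sim :: "nat \<Rightarrow> (bool list \<Rightarrow> bool list) \<Rightarrow> (bool list \<Rightarrow> bool list) \<Rightarrow> bool" where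
  "sim n f h \<longleftrightarrow> digraph_iso (with_proj (sync_graph n f)) (with_proj (sync_graph n h))"

definition derangement :: "nat \<Rightarrow> (bool list \<Rightarrow> bool list) \<Rightarrow> bool" where
  "derangement n f \<longleftrightarrow> bij_betw f (configs n) (configs n) \<and> (\<forall>x \<in> configs n. f x \<noteq> x)"

end

theory Submission
  imports Defs
begin

text \<open>
  The first two components split the cube into four layers 11, 00, 01, 10. We conjugate \<open>f\<close> so that
  every configuration of layer 11 is mapped to its antipode; then the asynchronous graph contains all
  arcs leaving layer 11, and a path from \<open>x\<close> to \<open>y\<close> climbs to layer 11, moves there along a geodesic
  and descends. Only the first two components are changed superfluously, which costs at most four
  extra steps.

  To arrange this, choose a maximum set of disjoint pairs \<open>(x, f x)\<close>; the unpaired elements \<open>Z\<close>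
  satisfy \<open>card Z \<le> 2 ^ n / 3\<close>. A quarter of all configurations, taken among the first elements of
  pairs, is placed in layer 11, and the remaining elements are labelled 01 and 10, as far as possible
  alternately along \<open>f\<close>, since an arc of \<open>f\<close> between these two layers yields both the arc up to
  layer 11 and the arc down to layer 00. If \<open>card Z \<le> 2 ^ (n - 2)\<close>, alternation is perfect and every
  position has a descent. Otherwise some positions have no descent and some configurations of layer
  10 are stuck, but then every configuration of layer 00 can be mapped to a configuration opposite in
  the last \<open>n - 2\<close> components, so that layer 00 can be traversed freely as well. All defects are put
  at positions with third component 0, where flipping that component repairs them.
\<close>

section \<open>Paths in asynchronous graphs\<close>

definition reach_within :: "'a rel \<Rightarrow> nat \<Rightarrow> 'a \<Rightarrow> 'a \<Rightarrow> bool" where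
  "reach_within E k x y \<longleftrightarrow> (\<exists>j\<le>k. (x, y) \<in> E ^^ j)"

lemma reach_within_refl: "reach_within E k x x"
  unfolding reach_within_def by (intro exI[of _ 0]) simp

lemma reach_within_arc: "(x, y) \<in> E \<Longrightarrow> reach_within E 1 x y"
  unfolding reach_within_def by (intro exI[of _ 1]) simp

lemma reach_within_trans:
  "reach_within E j x y \<Longrightarrow> reach_within E k y z \<Longrightarrow> reach_within E (j + k) x z"
  unfolding reach_within_def by (meson add_mono relpow_trans)

lemma reach_within_mono: "reach_within E j x y \<Longrightarrow> j \<le> k \<Longrightarrow> reach_within E k x y"
  unfolding reach_within_def by (meson le_trans)

text \<open>Cutting cycles out of a walk only shortens it, so bounds proved for walks carry over to
  the simple paths of \<open>apath\<close>.\<close>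

lemma (in wf_digraph) awalk_imp_apath_le:
  assumes "awalk u p v"
  shows "\<exists>q. apath u q v \<and> length q \<le> length p"
  using assms
proof (induct rule: awalk_to_apath_induct)
  case (path p)
  then show ?case by (auto simp: apath_def)
next
  case (decomp p q r s)
  then show ?case by (fastforce elim!: awalk_cyc_decompE)
qed

section \<open>Single arcs and the Hamming distance\<close>

lemma length_add_config [simp]: "length (x \<oplus>\<^sub>2 y) = min (length x) (length y)"
  by (simp add: add_config_def)

lemma length_unit_config [simp]: "length (unit_config n i) = n"
  by (simp add: unit_config_def)

lemma add_unit_config:
  assumes "length (xs @ c # ys) = n"
  shows "(xs @ c # ys) \<oplus>\<^sub>2 unit_config n (length xs) = xs @ (\<not> c) # ys"
proof (rule nth_equalityI)
  show "length ((xs @ c # ys) \<oplus>\<^sub>2 unit_config n (length xs)) = length (xs @ (\<not> c) # ys)"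
    using assms by simp
next
  fix i assume "i < length ((xs @ c # ys) \<oplus>\<^sub>2 unit_config n (length xs))"
  then have "i < n" using assms by simp
  then show "((xs @ c # ys) \<oplus>\<^sub>2 unit_config n (length xs)) ! i = (xs @ (\<not> c) # ys) ! i"
    using assms by (auto simp: add_config_def unit_config_def nth_append nth_Cons')
qed

lemma async_arc:
  assumes "length (xs @ c # ys) = n" "h (xs @ c # ys) ! length xs \<noteq> c"
  shows "(xs @ c # ys, xs @ (\<not> c) # ys) \<in> parcs (async_graph n h)"
proof -
  have "length xs < n" "(xs @ c # ys) ! length xs = c"
    using assms(1) by auto
  then show ?thesis
    using assms add_unit_config[OF assms(1)] unfolding async_graph_def configs_def
    by (auto intro!: exI[of _ "xs @ c # ys"] exI[of _ "length xs"])
qed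

lemma async_reach_imp_apath:
  assumes "reach_within (parcs (async_graph n h)) k x y" "x \<in> configs n"
  shows "\<exists>p. pre_digraph.apath (with_proj (async_graph n h)) x p y \<and> length p \<le> k"
proof -
  let ?G = "with_proj (async_graph n h)"
  interpret wf_digraph ?G
    by standard (auto simp: async_graph_def configs_def)
  have walk: "\<exists>p. awalk x p y \<and> length p = j"
    if "(x, y) \<in> parcs (async_graph n h) ^^ j" "x \<in> configs n" for j x
    using that
  proof (induction j arbitrary: x)
    case 0
    then show ?case by (simp add: awalk_Nil_iff) (simp add: async_graph_def)
  next
    case (Suc j)
    then obtain z where z: "(x, z) \<in> parcs (async_graph n h)"
      "(z, y) \<in> parcs (async_graph n h) ^^ j"
      by (meson relpow_Suc_D2)
    then have "z \<in> configs n" by (auto simp: async_graph_def configs_def)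
    with Suc z obtain p where "awalk z p y" "length p = j" by blast
    with z show ?case
      by (intro exI[of _ "(x, z) # p"]) (simp add: awalk_Cons_iff)
  qed
  from assms show ?thesis
    unfolding reach_within_def using walk awalk_imp_apath_le by (metis le_trans)
qed

lemma hamming_dist_Nil [simp]: "hamming_dist [] y = 0"
  by (simp add: hamming_dist_def)

lemma hamming_dist_Cons [simp]:
  "hamming_dist (a # x) (b # y) = of_bool (a \<noteq> b) + hamming_dist x y"
proof -
  have "{i. i < length (a # x) \<and> (a # x) ! i \<noteq> (b # y) ! i}
    = (if a \<noteq> b then {0} else {}) \<union> Suc ` {i. i < length x \<and> x ! i \<noteq> y ! i}"
    by (auto simp: nth_Cons' image_iff split: if_splits) (metis Suc_pred less_Suc_eq_0_disj not_less_eq)+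
  then show ?thesis
    unfolding hamming_dist_def by (auto simp: card_image)
qed

section \<open>Routes through freely traversable layers\<close>

text \<open>Complementing the last \<open>m\<close> components throughout a layer provides every arc
  that flips one of them, so the differing components can be corrected one by one from left to
  right.\<close>

lemma reach_antipodal_layer:
  assumes free: "\<And>r. length r = m \<Longrightarrow> \<exists>a' b'. h (a # b # r) = a' # b' # map Not r"
    and "length r = m" "length q = m"
  shows "reach_within (parcs (async_graph (m + 2) h)) (hamming_dist r q) (a # b # r) (a # b # q)"
proof -
  let ?E = "parcs (async_graph (m + 2) h)"
  \<comment> \<open>The prefix \<open>xs\<close> holds the components already corrected.\<close>
  have "reach_within ?E (hamming_dist r q) (a # b # xs @ r) (a # b # xs @ q)"
    if "length q = length r" "length xs + length r = m" for xs
    using that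
  proof (induction r arbitrary: q xs)
    case Nil
    then show ?case by (simp add: reach_within_refl)
  next
    case (Cons c r)
    then obtain d q' where q: "q = d # q'" by (cases q) auto
    have ih: "reach_within ?E (hamming_dist r q') (a # b # (xs @ [d]) @ r) (a # b # (xs @ [d]) @ q')"
      using Cons.prems q by (intro Cons.IH) auto
    show ?case
    proof (cases "c = d")
      case True
      then show ?thesis using ih q by simp
    next
      case False
      obtain a' b' where "h (a # b # xs @ c # r) = a' # b' # map Not (xs @ c # r)"
        using free[of "xs @ c # r"] Cons.prems by auto
      then have "((a # b # xs) @ c # r, (a # b # xs) @ (\<not> c) # r) \<in> ?E"
        using Cons.prems by (intro async_arc) (auto simp: nth_append)
      then have "reach_within ?E 1 (a # b # xs @ c # r) (a # b # (xs @ [d]) @ r)"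
        using False by (intro reach_within_arc) (cases c; cases d; simp)
      from reach_within_trans[OF this ih] show ?thesis using False q by simp
    qed
  qed
  from this[of "[]"] assms(2,3) show ?thesis by simp
qed

lemma async_arc0:
  "length r = m \<Longrightarrow> h (a # b # r) ! 0 \<noteq> a
    \<Longrightarrow> reach_within (parcs (async_graph (m + 2) h)) 1 (a # b # r) ((\<not> a) # b # r)"
  using async_arc[of "[]" a "b # r" "m + 2" h] by (intro reach_within_arc) simp

lemma async_arc1:
  "length r = m \<Longrightarrow> h (a # b # r) ! 1 \<noteq> b
    \<Longrightarrow> reach_within (parcs (async_graph (m + 2) h)) 1 (a # b # r) (a # (\<not> b) # r)"
  using async_arc[of "[a]" b r "m + 2" h] by (intro reach_within_arc) simp

lemma async_arc2:
  "length (c # r) = m \<Longrightarrow> h (a # b # c # r) ! 2 \<noteq> c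
    \<Longrightarrow> reach_within (parcs (async_graph (m + 2) h)) 1 (a # b # c # r) (a # b # (\<not> c) # r)"
  using async_arc[of "[a, b]" c r "m + 2" h] by (intro reach_within_arc) (simp add: numeral_2_eq_2)

lemma configs_add_2_cases:
  assumes "x \<in> configs (m + 2)"
  obtains a b r where "x = a # b # r" "length r = m"
  using assms by (auto simp: configs_def length_Suc_conv)

text \<open>Route: climb to layer 11, correct the last \<open>m\<close> components there, descend.
  At each position \<open>cross\<close> leaves a way down to layer 00 through layer 01 or layer
  10.\<close>

lemma reach_via_one_layer:
  assumes top: "\<And>r. length r = m \<Longrightarrow> h (True # True # r) = False # False # map Not r"
    and up01: "\<And>r. length r = m \<Longrightarrow> h (False # True # r) ! 0"
    and up10: "\<And>r. length r = m \<Longrightarrow> h (True # False # r) ! 1"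
    and up00: "\<And>r. length r = m \<Longrightarrow> h (False # False # r) ! 0 \<or> h (False # False # r) ! 1"
    and cross: "\<And>r. length r = m \<Longrightarrow> \<not> h (False # True # r) ! 1 \<or> \<not> h (True # False # r) ! 0"
    and x: "x \<in> configs (m + 2)" and y: "y \<in> configs (m + 2)"
  shows "reach_within (parcs (async_graph (m + 2) h)) (hamming_dist x y + 4) x y"
proof -
  let ?R = "reach_within (parcs (async_graph (m + 2) h))"
  obtain a b r where xr: "x = a # b # r" "length r = m" using x by (rule configs_add_2_cases)
  obtain c d q where yq: "y = c # d # q" "length q = m" using y by (rule configs_add_2_cases)
  note tr = reach_within_trans
  have mid: "?R (hamming_dist r q) (True # True # r) (True # True # q)"
    using top xr yq by (intro reach_antipodal_layer) auto
  have u1: "?R 1 (False # True # r) (True # True # r)"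
    using async_arc0[of r m h False True] up01 xr by simp
  have u2: "?R 1 (True # False # r) (True # True # r)"
    using async_arc1[of r m h True False] up10 xr by simp
  have u3: "?R (1 + 1) (False # False # r) (True # True # r)"
    using up00[OF xr(2)]
  proof
    assume "h (False # False # r) ! 0"
    then have "?R 1 (False # False # r) (True # False # r)"
      using async_arc0[of r m h False False] xr by simp
    from tr[OF this u2] show ?thesis .
  next
    assume "h (False # False # r) ! 1"
    then have "?R 1 (False # False # r) (False # True # r)"
      using async_arc1[of r m h False False] xr by simp
    from tr[OF this u1] show ?thesis .
  qed
  have d1: "?R 1 (True # True # q) (False # True # q)"
    using async_arc0[of q m h True True] top yq by simp
  have d2: "?R 1 (True # True # q) (True # False # q)"
    using async_arc1[of q m h True True] top yq by simp
  have d3: "?R (1 + 1) (True # True # q) (False # False # q)"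
    using cross[OF yq(2)]
  proof
    assume "\<not> h (False # True # q) ! 1"
    then have "?R 1 (False # True # q) (False # False # q)"
      using async_arc1[of q m h False True] yq by simp
    from tr[OF d1 this] show ?thesis .
  next
    assume "\<not> h (True # False # q) ! 0"
    then have "?R 1 (True # False # q) (False # False # q)"
      using async_arc0[of q m h True False] yq by simp
    from tr[OF d2 this] show ?thesis .
  qed
  have "?R (of_bool (\<not> a) + of_bool (\<not> b)) x (True # True # r)"
    unfolding xr using u1 u2 u3 by (cases a; cases b) (simp_all add: reach_within_refl)
  moreover have "?R (of_bool (\<not> c) + of_bool (\<not> d)) (True # True # q) y"
    unfolding yq using d1 d2 d3 by (cases c; cases d) (simp_all add: reach_within_refl)
  ultimately have "?R (of_bool (\<not> a) + of_bool (\<not> b) + hamming_dist r q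
      + (of_bool (\<not> c) + of_bool (\<not> d))) x y"
    using tr[OF tr[OF _ mid]] by blast
  \<comment> \<open>Each of the first two components costs at most 2 more than it contributes to the
    distance, namely when it is 0 in both \<open>x\<close> and \<open>y\<close>.\<close>
  then show ?thesis
    by (rule reach_within_mono) (simp add: xr yq of_bool_def)
qed

text \<open>Where \<open>r ! 0\<close> fails, the climb from layer 10 and the descent to layer 00
  may be missing; one flip of the third component leads to a good position. A target in layer 00 is
  then reached by descending elsewhere and moving inside layer 00, which \<open>bot\<close> makes
  free.\<close>

lemma reach_via_two_layers:
  assumes top: "\<And>r. length r = m \<Longrightarrow> h (True # True # r) = False # False # map Not r"
    and bot: "\<And>r. length r = m \<Longrightarrow> \<exists>a b. h (False # False # r) = a # b # map Not r"
    and up01: "\<And>r. length r = m \<Longrightarrow> h (False # True # r) ! 0"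
    and up10: "\<And>r. length r = m \<Longrightarrow> h (True # False # r) ! 1
      \<or> \<not> r ! 0 \<and> h (True # False # r) ! 2"
    and up10': "\<And>r. length r = m \<Longrightarrow> r ! 0 \<Longrightarrow> h (True # False # r) ! 1"
    and up00: "\<And>r. length r = m \<Longrightarrow> h (False # False # r) ! 1
      \<or> h (False # False # r) ! 0 \<and> h (True # False # r) ! 1"
    and cross: "\<And>r. length r = m \<Longrightarrow> r ! 0
      \<Longrightarrow> \<not> h (False # True # r) ! 1 \<or> \<not> h (True # False # r) ! 0"
    and m: "m > 0"
    and x: "x \<in> configs (m + 2)" and y: "y \<in> configs (m + 2)"
  shows "reach_within (parcs (async_graph (m + 2) h)) (hamming_dist x y + 4) x y"
proof -
  let ?R = "reach_within (parcs (async_graph (m + 2) h))"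
  obtain a b r where xr: "x = a # b # r" "length r = m" using x by (rule configs_add_2_cases)
  obtain c d q where yq: "y = c # d # q" "length q = m" using y by (rule configs_add_2_cases)
  note tr = reach_within_trans
  have mid: "?R (hamming_dist r q) (True # True # r) (True # True # q)"
    if "length r = m" for r
    using top that yq by (intro reach_antipodal_layer) auto
  have low: "?R (hamming_dist r q) (False # False # r) (False # False # q)"
    if "length r = m" for r
    using bot that yq by (intro reach_antipodal_layer) auto
  have u1: "?R 1 (False # True # r) (True # True # r)" if "length r = m" for r
    using async_arc0[of r m h False True] up01 that by simp
  have u2: "?R 1 (True # False # r) (True # True # r)"
    if "length r = m" "h (True # False # r) ! 1" for r
    using async_arc1[of r m h True False] that by simp
  have u3: "?R 2 (False # False # r) (True # True # r)" if "length r = m" for r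
    using up00[OF that]
  proof
    assume *: "h (False # False # r) ! 0 \<and> h (True # False # r) ! 1"
    then have "?R 1 (False # False # r) (True # False # r)"
      using async_arc0[of r m h False False] that by simp
    from tr[OF this u2] * that show ?thesis by (simp add: numeral_2_eq_2)
  next
    assume "h (False # False # r) ! 1"
    then have "?R 1 (False # False # r) (False # True # r)"
      using async_arc1[of r m h False False] that by simp
    from tr[OF this u1] that show ?thesis by (simp add: numeral_2_eq_2)
  qed
  have d1: "?R 1 (True # True # r) (False # True # r)" if "length r = m" for r
    using async_arc0[of r m h True True] top that by simp
  have d2: "?R 1 (True # True # r) (True # False # r)" if "length r = m" for r
    using async_arc1[of r m h True True] top that by simp
  have d3: "?R 2 (True # True # r) (False # False # r)" if "length r = m" "r ! 0" for r
    using cross[OF that]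
  proof
    assume "\<not> h (False # True # r) ! 1"
    then have "?R 1 (False # True # r) (False # False # r)"
      using async_arc1[of r m h False True] that by simp
    from tr[OF d1 this] that show ?thesis by (simp add: numeral_2_eq_2)
  next
    assume "\<not> h (True # False # r) ! 0"
    then have "?R 1 (True # False # r) (False # False # r)"
      using async_arc0[of r m h True False] that by simp
    from tr[OF d2 this] that show ?thesis by (simp add: numeral_2_eq_2)
  qed
  \<comment> \<open>\<open>t\<close> is the good position at or next to \<open>r\<close>.\<close>
  define t where "t = True # tl r"
  have t: "length t = m" "t ! 0" "hamming_dist t q \<le> hamming_dist r q + 1"
    using m xr yq by (cases r; cases q; simp add: t_def)+
  have step_t: "?R 1 (True # True # r) (True # True # t)" if "\<not> r ! 0"
    using async_arc2[of "r ! 0" "tl r" m h True True] top[of r] that xr m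
    by (cases r) (auto simp: t_def)
  \<comment> \<open>The worst case is one step to \<open>t\<close>, two steps down, and at most
    \<open>hamming_dist r q + 1\<close> steps in layer 00.\<close>
  have top_low: "?R (hamming_dist r q + 4) (True # True # r) (False # False # q)"
  proof (cases "r ! 0")
    case True
    from tr[OF d3[OF xr(2) True] low[OF xr(2)]] show ?thesis
      by (rule reach_within_mono) simp
  next
    case False
    from tr[OF step_t[OF False] tr[OF d3[OF t(1,2)] low[OF t(1)]]] show ?thesis
      by (rule reach_within_mono) (use t(3) in simp)
  qed
  have high: "?R (hamming_dist r q + 1) (True # True # r) y" if "c \<or> d" "length r = m" for r
  proof -
    have "?R 1 (True # True # q) y"
      using that d1 d2 yq by (cases c; cases d) (simp_all add: reach_within_refl)
    from tr[OF mid[OF that(2)] this] show ?thesis .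
  qed
  \<comment> \<open>A stuck configuration first flips its third component inside layer 10 and
    arrives in layer 11 at \<open>t\<close>.\<close>
  have stuck: "?R 2 (True # False # r) (True # True # t)" if "\<not> h (True # False # r) ! 1"
  proof -
    have "\<not> r ! 0" "h (True # False # r) ! 2" using up10[OF xr(2)] that by auto
    then have "?R 1 (True # False # r) (True # False # t)"
      using async_arc2[of "r ! 0" "tl r" m h True False] xr m by (cases r) (auto simp: t_def)
    from tr[OF this u2[OF t(1) up10'[OF t(1,2)]]] show ?thesis by (simp add: numeral_2_eq_2)
  qed
  have dist: "hamming_dist x y = of_bool (a \<noteq> c) + of_bool (b \<noteq> d) + hamming_dist r q"
    using xr yq by simp
  consider (stuck) "a" "\<not> b" "\<not> h (True # False # r) ! 1" | (low) "\<not> a" "\<not> b"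
    | (one) "a \<noteq> b" "?R 1 x (True # True # r)" | (top) "a" "b"
    using u1[OF xr(2)] u2[OF xr(2)] xr by (cases a; cases b) auto
  then show ?thesis
  proof cases
    case stuck': stuck
    then have up: "?R 2 x (True # True # t)" using stuck xr by simp
    show ?thesis
    proof (cases "c \<or> d")
      case True
      from tr[OF up high[OF True t(1)]] show ?thesis
        by (rule reach_within_mono) (use t(3) dist in simp)
    next
      \<comment> \<open>Two steps up, two down and at most \<open>hamming_dist r q + 1\<close>
        below; the fifth extra step is paid for by the first component, in which \<open>x\<close>
        and \<open>y\<close> differ.\<close>
      case False
      then have y: "y = False # False # q" using yq by simp
      from tr[OF up tr[OF d3[OF t(1,2)] low[OF t(1)]]] show ?thesis
        unfolding y by (rule reach_within_mono) (use t(3) dist False stuck' y in simp)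
    qed
  next
    case low': low
    show ?thesis
    proof (cases "c \<or> d")
      case True
      from tr[OF u3[OF xr(2)] high[OF True xr(2)]] have "?R (2 + (hamming_dist r q + 1)) x y"
        using low' xr by simp
      then show ?thesis by (rule reach_within_mono) (simp add: dist)
    next
      case False
      with low[OF xr(2)] low' xr yq have "?R (hamming_dist r q) x y" by simp
      then show ?thesis by (rule reach_within_mono) (simp add: dist)
    qed
  next
    case one
    show ?thesis
    proof (cases "c \<or> d")
      case True
      from tr[OF one(2) high[OF True xr(2)]] show ?thesis
        by (rule reach_within_mono) (simp add: dist)
    next
      case False
      then have y: "y = False # False # q" using yq by simp
      from tr[OF one(2) top_low] show ?thesis
        unfolding y by (rule reach_within_mono) (use False dist one y in \<open>cases a; simp\<close>)
    qed
  next
    case top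
    show ?thesis
    proof (cases "c \<or> d")
      case True
      with high[OF True xr(2)] top xr have "?R (hamming_dist r q + 1) x y" by simp
      then show ?thesis by (rule reach_within_mono) (simp add: dist)
    next
      case False
      with top_low top xr yq have "?R (hamming_dist r q + 4) x y" by simp
      then show ?thesis by (rule reach_within_mono) (simp add: dist)
    qed
  qed
qed

section \<open>Pairings of derangements\<close>

locale paired_derangement =
  fixes X :: "'a set" and f :: "'a \<Rightarrow> 'a" and P Z :: "'a set"
  assumes finite_X: "finite X" and bij: "bij_betw f X X"
    and P_subset: "P \<subseteq> X" and P_disj: "P \<inter> f ` P = {}" and Z_eq: "Z = X - P - f ` P"
    and f_Z: "\<And>z. z \<in> Z \<Longrightarrow> f z \<in> P"
    and Z_chain: "\<And>z. z \<in> Z \<Longrightarrow> f (f (f z)) \<in> Z \<Longrightarrow> f (f (f z)) = z"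

text \<open>Take \<open>P\<close> of maximum cardinality. The condition on \<open>f (f (f z))\<close> comes from an exchange:
otherwise \<open>f z\<close> could be replaced in \<open>P\<close> by the two elements \<open>z\<close> and \<open>f (f z)\<close>.\<close>

lemma paired_derangement_exists:
  assumes fin: "finite X" and bij: "bij_betw f X X" and nofix: "\<And>x. x \<in> X \<Longrightarrow> f x \<noteq> x"
  shows "\<exists>P. paired_derangement X f P (X - P - f ` P)"
proof -
  let ?Q = "\<lambda>P. P \<subseteq> X \<and> P \<inter> f ` P = {}"
  have "\<forall>P. ?Q P \<longrightarrow> card P < Suc (card X)"
    using card_mono[OF fin] by (auto simp: less_Suc_eq_le)
  then obtain P where PQ: "?Q P \<and> (\<forall>P'. ?Q P' \<longrightarrow> card P' \<le> card P)"
    using ex_has_greatest_nat[of ?Q "{}" card "Suc (card X)"] by auto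
  then have P: "P \<subseteq> X" "P \<inter> f ` P = {}" by simp_all
  have max: "card P' \<le> card P" if "P' \<subseteq> X" "P' \<inter> f ` P' = {}" for P'
    using PQ that by simp
  define Z where "Z = X - P - f ` P"
  have fX: "f x \<in> X" if "x \<in> X" for x using bij that by (auto simp: bij_betw_def)
  have inj: "f x = f y \<longleftrightarrow> x = y" if "x \<in> X" "y \<in> X" for x y
    using bij that by (auto simp: bij_betw_def inj_on_def)
  have finP: "finite P" using P fin finite_subset by blast
  have ZX: "z \<in> X" "z \<notin> P" "z \<notin> f ` P" if "z \<in> Z" for z using that by (auto simp: Z_def)
  \<comment> \<open>Otherwise \<open>(z, f z)\<close> would be a further pair disjoint from all
    others.\<close>
  have fZ: "f z \<in> P" if z: "z \<in> Z" for z
  proof (rule ccontr)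
    assume "f z \<notin> P"
    then have "insert z P \<inter> f ` insert z P = {}"
      using P(2) ZX[OF z] nofix by auto
    then show False using max[of "insert z P"] P(1) ZX[OF z] finP by simp
  qed
  have "f (f (f z)) = z" if z: "z \<in> Z" and z': "f (f (f z)) \<in> Z" for z
  proof (rule ccontr)
    assume ne: "f (f (f z)) \<noteq> z"
    let ?P = "insert z (insert (f (f z)) (P - {f z}))"
    note zX = ZX[OF z] and z'X = ZX[OF z']
    have sub: "?P \<subseteq> X" using P(1) zX fX by auto
    have ffz: "f (f z) \<notin> P" "f (f z) \<noteq> z" using imageI[OF fZ[OF z], of f] P(2) zX by auto
    have "?P \<inter> f ` ?P = {}"
    proof -
      have "f x \<notin> ?P" if x: "x \<in> ?P" for x
      proof -
        consider "x = z" | "x = f (f z)" | "x \<in> P" "x \<noteq> f z" using x by auto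
        then show ?thesis
        proof cases
          case 1
          then show ?thesis using nofix zX fX by (metis DiffE ffz(2) insertE insertI1)
        next
          case 2
          then show ?thesis using ne z'X nofix zX fX by (metis DiffE insertE)
        next
          case 3
          then have "f x \<notin> P" "f x \<noteq> z" using P(2) zX by auto
          moreover have "f x \<noteq> f (f z)" using 3 inj P(1) fX zX by auto
          ultimately show ?thesis by simp
        qed
      qed
      then show ?thesis by (simp only: disjoint_iff image_iff) metis
    qed
    then have "card ?P \<le> card P" using max sub by blast
    moreover have "card ?P = Suc (Suc (card (P - {f z})))"
      using ffz zX finP by simp
    moreover have "Suc (card (P - {f z})) = card P"
      using fZ[OF z] finP by (rule card_Suc_Diff1[rotated])
    ultimately show False by simp
  qed
  then show ?thesis
    using fin bij P fZ unfolding Z_def by (intro exI[of _ P]) (unfold_locales, auto)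
qed

section \<open>Labels 01 and 10 along the orbits\<close>

text \<open>When \<open>Q\<close> consists of first elements of pairs, a step by
  \<open>f \<circ> f\<close> goes from one pair to the pair following it; propagation ends on
  leaving \<open>Q\<close>.\<close>

inductive_set alternate_orbit :: "('a \<Rightarrow> 'a) \<Rightarrow> 'a set \<Rightarrow> 'a set \<Rightarrow> 'a set"
  for f :: "'a \<Rightarrow> 'a" and S Q :: "'a set" where
  start: "z \<in> S \<Longrightarrow> f z \<in> Q \<Longrightarrow> f z \<in> alternate_orbit f S Q"
| step: "x \<in> alternate_orbit f S Q \<Longrightarrow> f (f x) \<in> Q \<Longrightarrow> f (f x) \<in> alternate_orbit f S Q"

lemma alternate_orbit_subset: "alternate_orbit f S Q \<subseteq> Q"
proof
  fix x assume "x \<in> alternate_orbit f S Q"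
  then show "x \<in> Q" by induction
qed

context paired_derangement
begin

lemma f_in_X [simp]: "x \<in> X \<Longrightarrow> f x \<in> X"
  using bij by (auto simp: bij_betw_def)

lemma f_inj: "x \<in> X \<Longrightarrow> y \<in> X \<Longrightarrow> f x = f y \<longleftrightarrow> x = y"
  using bij by (auto simp: bij_betw_def inj_on_def)

lemma inj_f: "S \<subseteq> X \<Longrightarrow> inj_on f S"
  using bij by (meson bij_betw_def inj_on_subset)

lemma finite_subset_X: "S \<subseteq> X \<Longrightarrow> finite S"
  using finite_X finite_subset by blast

lemma card_f: "S \<subseteq> X \<Longrightarrow> card (f ` S) = card S"
  by (simp add: card_image inj_f)

lemma Z_subset: "Z \<subseteq> X" by (auto simp: Z_eq)

lemma X_eq: "X = P \<union> f ` P \<union> Z"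
  using P_subset by (auto simp: Z_eq)

lemma Z_disj: "Z \<inter> P = {}" "Z \<inter> f ` P = {}"
  by (auto simp: Z_eq)

lemma card_X: "card X = 2 * card P + card Z"
proof -
  have "card X = card (P \<union> f ` P) + card Z"
    using P_subset Z_subset Z_disj by (subst X_eq, subst card_Un_disjoint)
      (auto intro: finite_subset_X)
  also have "card (P \<union> f ` P) = card P + card (f ` P)"
    using P_subset P_disj by (intro card_Un_disjoint) (auto intro: finite_subset_X)
  finally show ?thesis using card_f[OF P_subset] by simp
qed

text \<open>\<open>f\<close> maps \<open>Z\<close> injectively into \<open>P\<close>. With
  \<open>card_X\<close> this gives \<open>3 * card Z \<le> card X\<close>.\<close>

lemma card_Z_le: "card Z \<le> card P"
  using f_Z Z_subset P_subset
  by (metis card_f card_mono finite_subset_X image_subsetI)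

text \<open>As \<open>f x\<close> is not in \<open>P\<close>, injectivity keeps its image from being
  the second element of a pair.\<close>

lemma ff_P: "x \<in> P \<Longrightarrow> f (f x) \<in> P \<union> Z"
proof -
  assume x: "x \<in> P"
  then have "x \<in> X" "f x \<notin> P" using P_subset P_disj by auto
  then have "f (f x) \<notin> f ` P" using f_inj P_subset by (metis f_in_X image_iff subsetD)
  moreover have "f (f x) \<in> P \<union> f ` P \<union> Z" using \<open>x \<in> X\<close> by (subst X_eq[symmetric]) simp
  ultimately show ?thesis by blast
qed

lemma card_ff: "S \<subseteq> X \<Longrightarrow> card ((\<lambda>x. f (f x)) ` S) = card S"
  by (intro card_image inj_onI) (metis f_in_X f_inj subsetD)

text \<open>A predecessor in \<open>Z\<close> would put \<open>z\<close> into \<open>P\<close>, and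
  one in \<open>P\<close> would make \<open>z\<close> paired; only second elements of pairs
  remain.\<close>

lemma Z_preimage: "z \<in> Z \<Longrightarrow> \<exists>x\<in>P. z = f (f x)"
proof -
  assume z: "z \<in> Z"
  then obtain w where w: "w \<in> X" "z = f w" using Z_subset bij by (metis bij_betw_def imageE subsetD)
  then have "w \<notin> Z" "w \<notin> P" using f_Z Z_disj z by auto
  moreover have "w \<in> P \<union> f ` P \<union> Z" using w(1) by (subst X_eq[symmetric])
  ultimately show ?thesis using w(2) by auto
qed

text \<open>The pairs outside \<open>PH\<close> are normally labelled \<open>A\<close> then \<open>B\<close>. After an element of \<open>ZA\<close>
the labels must be exchanged, and the exchange is propagated along \<open>f \<circ> f\<close> as long as one stays in
\<open>P - PH\<close>. The set \<open>St\<close> collects the places where two labels \<open>B\<close> follow each other.\<close>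

lemma labelling:
  assumes PH: "PH \<subseteq> P" and ZAB: "Z = ZA \<union> ZB" "ZA \<inter> ZB = {}" "card ZA = card ZB"
    and cardX: "card X = 4 * card PH"
    and late: "\<And>x. x \<in> P - PH \<Longrightarrow> f (f x) \<notin> ZA"
  obtains A B St where
    "X = PH \<union> f ` PH \<union> A \<union> B"
    "PH \<inter> f ` PH = {}" "PH \<inter> A = {}" "PH \<inter> B = {}" "f ` PH \<inter> A = {}" "f ` PH \<inter> B = {}" "A \<inter> B = {}"
    "card A = card PH" "card B = card PH" "ZA \<subseteq> A" "ZB \<subseteq> B"
    "\<forall>x\<in>A. f x \<in> PH \<union> B" "\<forall>x\<in>B - St. f x \<in> PH \<union> A"
    "St \<subseteq> B" "St \<subseteq> f ` {x \<in> P - PH. f (f x) \<in> Z}"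
proof -
  define PM where "PM = P - PH"
  define V where "V = alternate_orbit f ZA PM"
  define A where "A = ZA \<union> (PM - V) \<union> f ` V"
  define B where "B = ZB \<union> V \<union> f ` (PM - V)"
  define St where "St = f ` {x \<in> PM - V. f (f x) \<in> Z}"
  have V: "V \<subseteq> PM" unfolding V_def by (rule alternate_orbit_subset)
  have PM: "PM \<subseteq> P" "PM \<inter> PH = {}" "P = PH \<union> PM" using PH by (auto simp: PM_def)
  have sX: "ZA \<subseteq> X" "ZB \<subseteq> X" "PM \<subseteq> X" "V \<subseteq> X" "PH \<subseteq> X"
    using ZAB Z_subset PM PH P_subset V by auto
  have imP: "f x \<notin> P" "f x \<notin> Z" if "x \<in> P" for x using P_disj Z_disj that by auto
  \<comment> \<open>Predecessors are unique and tell whether an element was reached from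
    \<open>ZA\<close> or from an earlier pair, so membership in \<open>V\<close> is decided exactly,
    here and in \<open>step_iff\<close>.\<close>
  have start_iff: "f z \<in> V \<longleftrightarrow> z \<in> ZA" if "z \<in> Z" "f z \<in> PM" for z
  proof
    assume "f z \<in> V"
    then show "z \<in> ZA" unfolding V_def
    proof cases
      case (start z')
      then show ?thesis using f_inj sX that(1) Z_subset by (metis subsetD)
    next
      case (step x)
      then have "x \<in> P" using subsetD[OF alternate_orbit_subset] PM(1) by fast
      then have "z = f x" using step(1) f_inj that(1) Z_subset P_subset by (metis subsetD f_in_X)
      then show ?thesis using imP \<open>x \<in> P\<close> that(1) by auto
    qed
  qed (auto simp: V_def that intro: alternate_orbit.start)
  have step_iff: "f (f x) \<in> V \<longleftrightarrow> x \<in> V" if "x \<in> PM" "f (f x) \<in> PM" for x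
  proof
    assume "f (f x) \<in> V"
    then have "f (f x) \<in> alternate_orbit f ZA PM" unfolding V_def .
    then show "x \<in> V"
    proof cases
      case (start z)
      then have "f x = z" using f_inj sX that(1) by (metis subsetD f_in_X)
      then show ?thesis using imP that(1) PM(1) start ZAB(1) by blast
    next
      case (step y)
      then have "y \<in> X" using subsetD[OF alternate_orbit_subset] sX(3) by fast
      then have "x = y" using step(1) f_inj that(1) sX by (metis subsetD f_in_X)
      then show ?thesis using step unfolding V_def by simp
    qed
  qed (auto simp: V_def that intro: alternate_orbit.step)
  have ZAs: "ZA \<subseteq> Z" "ZB \<subseteq> Z" using ZAB(1) by auto
  have 1: "X = PH \<union> f ` PH \<union> A \<union> B"
  proof -
    have "P = PH \<union> (PM - V) \<union> V" using PM V by blast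
    then have "f ` P = f ` PH \<union> f ` (PM - V) \<union> f ` V" by (metis image_Un)
    with \<open>P = PH \<union> (PM - V) \<union> V\<close> ZAB(1) X_eq show ?thesis
      unfolding A_def B_def by blast
  qed
  have 2: "PH \<inter> f ` PH = {}" using PH P_disj by blast
  have img: "f ` S \<inter> f ` T = {}" if "S \<inter> T = {}" "S \<subseteq> P" "T \<subseteq> P" for S T
    using that P_subset inj_on_image_Int[OF inj_f[OF subset_refl], of S T] by auto
  have i: "f ` PH \<inter> f ` V = {}" "f ` PH \<inter> f ` (PM - V) = {}" "f ` V \<inter> f ` (PM - V) = {}"
    using img[of PH V] img[of PH "PM - V"] img[of V "PM - V"] PM V PH by blast+
  have PZ: "S \<inter> T = {}" "T \<inter> S = {}" if "S \<in> {PH, PM - V, V}" "T \<in> {ZA, ZB}" for S T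
    using that PH PM(1) V ZAs Z_disj(1) by blast+
  have PfP: "S \<inter> f ` T = {}" "f ` T \<inter> S = {}"
    if "S \<in> {PH, PM - V, V}" "T \<in> {PH, PM - V, V}" for S T
    using that PH PM(1) V P_disj by blast+
  have ZfP: "S \<inter> f ` T = {}" "f ` T \<inter> S = {}"
    if "S \<in> {ZA, ZB}" "T \<in> {PH, PM - V, V}" for S T
    using that PH PM(1) V ZAs Z_disj(2) by blast+
  have PM': "PH \<inter> (PM - V) = {}" "PH \<inter> V = {}" "(PM - V) \<inter> V = {}"
    using PM(2) V by blast+
  have disjs: "PH \<inter> A = {}" "PH \<inter> B = {}" "f ` PH \<inter> A = {}" "f ` PH \<inter> B = {}" "A \<inter> B = {}"
    unfolding A_def B_def by (simp_all add: Int_Un_distrib Int_Un_distrib2 i PZ PfP ZfP PM' ZAB(2))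
  have finA: "finite S" if "S \<subseteq> X" for S using that finite_subset_X by blast
  have d3: "card (S \<union> T \<union> U) = card S + card T + card U"
    if "S \<inter> T = {}" "S \<inter> U = {}" "T \<inter> U = {}" "S \<subseteq> X" "T \<subseteq> X" "U \<subseteq> X" for S T U
    using that by (simp add: card_Un_disjoint finA Int_Un_distrib2)
  have "card A = card ZA + card (PM - V) + card (f ` V)"
    unfolding A_def
  proof (rule d3)
    show "ZA \<inter> (PM - V) = {}" "ZA \<inter> f ` V = {}" "(PM - V) \<inter> f ` V = {}"
      by (simp_all add: PZ PfP ZfP)
  qed (use sX in auto)
  moreover have "card B = card ZB + card V + card (f ` (PM - V))"
    unfolding B_def
  proof (rule d3)
    show "ZB \<inter> V = {}" "ZB \<inter> f ` (PM - V) = {}" "V \<inter> f ` (PM - V) = {}"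
      by (simp_all add: PZ PfP ZfP)
  qed (use sX in auto)
  moreover have "card (PM - V) + card V = card PM"
    using V sX by (metis card_Diff_subset card_mono finA le_add_diff_inverse2)
  moreover have "card PM + card PH = card P"
    using PM sX card_Un_disjoint[of PH PM] finA by (simp add: Int_commute)
  moreover have "card Z = card ZA + card ZB"
    using ZAB sX card_Un_disjoint[of ZA ZB] finA by simp
  moreover have "card (f ` V) = card V" "card (f ` (PM - V)) = card (PM - V)"
    using sX card_f[of V] card_f[of "PM - V"] by auto
  \<comment> \<open>Both sets consist of \<open>card PM\<close> paired elements and half of
    \<open>Z\<close>; this makes \<open>card PH\<close>, since
    \<open>2 * card P + card Z = 4 * card PH\<close>.\<close>
  ultimately have cards: "card A = card PH" "card B = card PH"
    using card_X cardX ZAB(3) by linarith+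
  have Pc: "y \<in> PH \<or> y \<in> PM" if "y \<in> P" for y using that by (simp add: PM_def)
  have Zc: "z \<in> ZA \<or> z \<in> ZB" if "z \<in> Z" for z using that ZAB(1) by simp
  have zb: "f z \<in> PH \<union> A" if "z \<in> ZB" for z
  proof -
    have z: "z \<in> Z" "z \<notin> ZA" using that ZAs ZAB(2) by blast+
    from Pc[OF f_Z[OF z(1)]] show ?thesis
      using start_iff[OF z(1)] z(2) by (auto simp: A_def)
  qed
  have a: "f x \<in> PH \<union> B" if xA: "x \<in> A" for x
  proof -
    consider "x \<in> ZA" | "x \<in> PM - V" | y where "y \<in> V" "x = f y"
      using xA unfolding A_def by blast
    then show ?thesis
    proof cases
      case 1
      then have z: "x \<in> Z" using ZAs by blast
      from Pc[OF f_Z[OF z]] show ?thesis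
        using start_iff[OF z] 1 by (auto simp: B_def)
    next
      case 2
      then show ?thesis unfolding B_def by blast
    next
      case 3
      then have y: "y \<in> PM" using V by blast
      \<comment> \<open>\<open>x\<close> is the second element of an exchanged pair and carries
        \<open>A\<close>; by \<open>late\<close> an unpaired successor lies in \<open>ZB\<close>, as
        required.\<close>
      then have "f x \<notin> ZA" using late 3 by (simp add: PM_def)
      moreover have "f x \<in> P \<union> Z" using ff_P[of y] y PM(1) 3 by blast
      ultimately show ?thesis
        using step_iff[OF y] 3 Pc[of "f x"] Zc[of "f x"] by (auto simp: B_def)
    qed
  qed
  have b: "f x \<in> PH \<union> A" if xB: "x \<in> B - St" for x
  proof -
    consider "x \<in> ZB" | "x \<in> V" | y where "y \<in> PM - V" "x = f y"
      using xB unfolding B_def by blast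
    then show ?thesis
    proof cases
      case 1
      then show ?thesis by (rule zb)
    next
      case 2
      then show ?thesis unfolding A_def by blast
    next
      case 3
      then have y: "y \<in> PM" by blast
      \<comment> \<open>An unpaired successor would lie in \<open>ZB\<close> and repeat the label
        \<open>B\<close>; these places form \<open>St\<close>.\<close>
      have "f x \<notin> Z" using 3 xB unfolding St_def by blast
      moreover have "f x \<in> P \<union> Z" using ff_P[of y] y PM(1) 3 by blast
      ultimately show ?thesis
        using step_iff[OF y] 3 Pc[of "f x"] by (auto simp: A_def)
    qed
  qed
  have St: "St \<subseteq> B" "St \<subseteq> f ` {x \<in> P - PH. f (f x) \<in> Z}"
    by (auto simp: St_def B_def PM_def)
  have "ZA \<subseteq> A" "ZB \<subseteq> B" by (auto simp: A_def B_def)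
  from that[OF 1 2 disjs cards this ballI[OF a] ballI[OF b] St] show ?thesis .
qed

end

section \<open>Layered conjugates\<close>

lemma finite_configs [simp]: "finite (configs n)"
  and card_configs: "card (configs n) = 2 ^ n"
  using finite_lists_length_eq[of "UNIV :: bool set" n] card_lists_length_eq[of "UNIV :: bool set" n]
  by (simp_all add: configs_def card_UNIV_bool)

text \<open>The arcs are the pairs \<open>(y, h y)\<close>, and \<open>map_prod k k\<close> carries
  them onto the pairs \<open>(k y, f (k y))\<close>.\<close>

lemma simI:
  assumes "h \<in> F n" "bij_betw k (configs n) (configs n)"
    and conj: "\<And>y. y \<in> configs n \<Longrightarrow> k (h y) = f (k y)"
  shows "sim n h f"
proof -
  let ?G = "with_proj (sync_graph n h)"
  let ?i = "\<lparr>iso_verts = k, iso_arcs = map_prod k k, iso_head = snd, iso_tail = fst\<rparr>"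
  have hX: "h y \<in> configs n" if "y \<in> configs n" for y
    using assms(1) that by (auto simp: F_def)
  have k: "inj_on k (configs n)" "k ` configs n = configs n"
    using assms(2) by (auto simp: bij_betw_def)
  interpret wf_digraph ?G
    by standard (auto simp: sync_graph_def hX)
  have "inj_on (map_prod k k) (configs n \<times> configs n)"
    using k(1) by (intro map_prod_inj_on)
  then have "inj_on (map_prod k k) (parcs (sync_graph n h))"
    by (rule inj_on_subset) (auto simp: sync_graph_def hX)
  then have "digraph_isomorphism ?i"
    using k(1) wf_digraph_axioms by (simp add: digraph_isomorphism_def) (simp add: sync_graph_def)
  moreover have "map_prod k k ` parcs (sync_graph n h) = parcs (sync_graph n f)"
  proof
    show "map_prod k k ` parcs (sync_graph n h) \<subseteq> parcs (sync_graph n f)"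
      using k(2) conj by (auto simp: sync_graph_def)
    show "parcs (sync_graph n f) \<subseteq> map_prod k k ` parcs (sync_graph n h)"
    proof
      fix e assume "e \<in> parcs (sync_graph n f)"
      then obtain x where "e = (x, f x)" "x \<in> configs n" by (auto simp: sync_graph_def)
      moreover then obtain y where "y \<in> configs n" "x = k y" using k(2) by blast
      ultimately have "e = map_prod k k (y, h y)" "(y, h y) \<in> parcs (sync_graph n h)"
        using conj by (auto simp: sync_graph_def)
      then show "e \<in> map_prod k k ` parcs (sync_graph n h)" by (rule image_eqI)
    qed
  qed
  then have "with_proj (sync_graph n f) = app_iso ?i ?G"
    using k(2) by (simp add: app_iso_def with_proj_def) (simp add: sync_graph_def)
  ultimately show ?thesis
    unfolding sim_def digraph_iso_def by blast
qed

lemma bij_betw_preimage: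
  assumes "bij_betw k S R" "r \<in> R"
  obtains x where "x \<in> S" "k x = r"
  using assms by (metis bij_betw_def imageE)

text \<open>Used to fix the positions of a few elements and to fill in the others
  arbitrarily.\<close>

lemma extend_to_bij:
  assumes "finite A" "finite B" "card A = card B" "N \<subseteq> A" "inj_on \<phi> N" "\<phi> ` N \<subseteq> B"
  obtains \<rho> where "bij_betw \<rho> A B" "\<And>x. x \<in> N \<Longrightarrow> \<rho> x = \<phi> x"
proof -
  have "card (A - N) = card (B - \<phi> ` N)"
    using assms by (metis card_Diff_subset card_image finite_subset)
  then obtain \<psi> where \<psi>: "bij_betw \<psi> (A - N) (B - \<phi> ` N)"
    using assms finite_same_card_bij by (metis finite_Diff)
  let ?\<rho> = "\<lambda>x. if x \<in> N then \<phi> x else \<psi> x"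
  have "bij_betw ?\<rho> N (\<phi> ` N)"
    using assms(5) by (auto simp: bij_betw_def inj_on_def)
  moreover have "bij_betw ?\<rho> (A - N) (B - \<phi> ` N)"
    using \<psi> by (subst bij_betw_cong[of _ _ \<psi>]) auto
  ultimately have "bij_betw ?\<rho> (N \<union> (A - N)) (\<phi> ` N \<union> (B - \<phi> ` N))"
    by (rule bij_betw_combine) auto
  moreover have "N \<union> (A - N) = A" "\<phi> ` N \<union> (B - \<phi> ` N) = B" using assms by auto
  ultimately have "bij_betw ?\<rho> A B" by simp
  then show ?thesis by (rule that) simp
qed

text \<open>Layers and positions define a relabelling \<open>g\<close> of the cube, and
  \<open>h\<close> is \<open>f\<close> transported along \<open>g\<close>.\<close>

lemma layered_realization:
  assumes f: "bij_betw f (configs (m + 2)) (configs (m + 2))"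
    and X: "configs (m + 2) = PH \<union> f ` PH \<union> A \<union> B"
    and disj: "PH \<inter> f ` PH = {}" "PH \<inter> A = {}" "PH \<inter> B = {}" "f ` PH \<inter> A = {}" "f ` PH \<inter> B = {}"
      "A \<inter> B = {}"
    and \<rho>: "bij_betw \<rho>H PH (configs m)" "bij_betw \<rho>A A (configs m)" "bij_betw \<rho>B B (configs m)"
  obtains g h where "h \<in> F (m + 2)" "sim (m + 2) h f"
    "\<forall>x\<in>PH. g x = True # True # \<rho>H x"
    "\<forall>x\<in>PH. g (f x) = False # False # map Not (\<rho>H x)"
    "\<forall>x\<in>A. g x = False # True # \<rho>A x"
    "\<forall>x\<in>B. g x = True # False # \<rho>B x"
    "\<forall>x\<in>configs (m + 2). h (g x) = g (f x)"
proof -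
  \<comment> \<open>The last branch of \<open>g\<close> serves the images of \<open>PH\<close> under
    \<open>f\<close>; complementing there makes \<open>f x\<close> the antipode of
    \<open>x\<close>.\<close>
  let ?X = "configs (m + 2)"
  define g where "g x = (if x \<in> PH then True # True # \<rho>H x else if x \<in> A then False # True # \<rho>A x
    else if x \<in> B then True # False # \<rho>B x
    else False # False # map Not (\<rho>H (inv_into PH f x)))" for x
  have sX: "PH \<subseteq> ?X" "f ` PH \<subseteq> ?X" "A \<subseteq> ?X" "B \<subseteq> ?X" unfolding X by auto
  then have injf: "inj_on f PH"
    using f by (meson bij_betw_def inj_on_subset)
  have gH: "g x = True # True # \<rho>H x" if "x \<in> PH" for x using that by (simp add: g_def)
  have gA: "g x = False # True # \<rho>A x" if "x \<in> A" for x
  proof -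
    have "x \<notin> PH" using that disj(2) by auto
    then show ?thesis using that by (simp add: g_def)
  qed
  have gB: "g x = True # False # \<rho>B x" if "x \<in> B" for x
  proof -
    have "x \<notin> PH" "x \<notin> A" using that disj(3,6) by auto
    then show ?thesis using that by (simp add: g_def)
  qed
  have gL: "g (f x) = False # False # map Not (\<rho>H x)" if "x \<in> PH" for x
  proof -
    have "f x \<notin> PH" "f x \<notin> A" "f x \<notin> B"
      using that disj(1,4,5) imageI[OF that, of f] by auto
    then show ?thesis using that injf by (simp add: g_def)
  qed
  have ran: "\<rho>H x \<in> configs m" if "x \<in> PH" for x using \<rho>(1) that by (auto simp: bij_betw_def)
  have ranA: "\<rho>A x \<in> configs m" if "x \<in> A" for x using \<rho>(2) that by (auto simp: bij_betw_def)
  have ranB: "\<rho>B x \<in> configs m" if "x \<in> B" for x using \<rho>(3) that by (auto simp: bij_betw_def)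
  have into: "g x \<in> ?X" if xX: "x \<in> ?X" for x
  proof -
    consider "x \<in> PH" | y where "y \<in> PH" "x = f y" | "x \<in> A" | "x \<in> B"
      using xX unfolding X by auto
    then show ?thesis
      by cases (use gH gL gA gB ran ranA ranB in \<open>auto simp: configs_def\<close>)
  qed
  \<comment> \<open>Every position of every layer is hit; on a finite set this also yields
    injectivity.\<close>
  have "?X \<subseteq> g ` ?X"
  proof
    fix y assume "y \<in> ?X"
    then obtain a b r where y: "y = a # b # r" "length r = m" by (rule configs_add_2_cases)
    then have r: "r \<in> configs m" "map Not r \<in> configs m" by (auto simp: configs_def)
    obtain x1 where x1: "x1 \<in> PH" "\<rho>H x1 = r" using \<rho>(1) r(1) by (rule bij_betw_preimage)
    obtain x2 where x2: "x2 \<in> PH" "\<rho>H x2 = map Not r" using \<rho>(1) r(2) by (rule bij_betw_preimage)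
    obtain x3 where x3: "x3 \<in> A" "\<rho>A x3 = r" using \<rho>(2) r(1) by (rule bij_betw_preimage)
    obtain x4 where x4: "x4 \<in> B" "\<rho>B x4 = r" using \<rho>(3) r(1) by (rule bij_betw_preimage)
    have "map Not (map Not r) = r" by (simp add: comp_def)
    then have "g x1 = True # True # r" "g (f x2) = False # False # r" "g x3 = False # True # r"
      "g x4 = True # False # r"
      using gH gL gA gB x1 x2 x3 x4 by auto
    moreover have "x1 \<in> ?X" "f x2 \<in> ?X" "x3 \<in> ?X" "x4 \<in> ?X" using sX x1 x2 x3 x4 by auto
    ultimately show "y \<in> g ` ?X" unfolding y(1) by (cases a; cases b) (metis imageI)+
  qed
  then have g: "bij_betw g ?X ?X"
    using into finite_surj_inj[of ?X g] by (auto simp: bij_betw_def)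
  define k where "k = inv_into ?X g"
  have k: "bij_betw k ?X ?X" "\<And>x. x \<in> ?X \<Longrightarrow> k (g x) = x"
    unfolding k_def using bij_betw_inv_into[OF g] g by (auto simp: bij_betw_inv_into_left)
  define h where "h y = g (f (k y))" for y
  have kX: "k x \<in> ?X" "f x \<in> ?X" if "x \<in> ?X" for x using k(1) f that by (auto simp: bij_betw_def)
  show ?thesis
  proof (rule that[OF _ _ ballI[OF gH] ballI[OF gL] ballI[OF gA] ballI[OF gB] ballI])
    show "h \<in> F (m + 2)" using into kX by (auto simp: h_def F_def)
    then show "sim (m + 2) h f" by (rule simI[OF _ k(1)]) (use kX k(2) in \<open>auto simp: h_def\<close>)
    show "h (g x) = g (f x)" if "x \<in> ?X" for x using k(2) that by (simp add: h_def)
  qed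
qed

section \<open>The cases of few and of many unpaired configurations\<close>

text \<open>Here \<open>PH\<close> can contain every first element whose pair is followed by an
  unpaired element. Hence \<open>St\<close> is empty and layer 11 alone suffices for the
  routes.\<close>

lemma few_unpaired:
  assumes "paired_derangement (configs (m + 2)) f P Z" "card Z \<le> 2 ^ m"
  shows "\<exists>h \<in> F (m + 2). sim (m + 2) h f \<and> (\<forall>x \<in> configs (m + 2). \<forall>y \<in> configs (m + 2).
    reach_within (parcs (async_graph (m + 2) h)) (hamming_dist x y + 4) x y)"
proof -
  interpret paired_derangement "configs (m + 2)" f P Z by fact
  let ?X = "configs (m + 2)"
  define T where "T = {x \<in> P. f (f x) \<in> Z}"
  have cX: "4 * 2 ^ m = 2 * card P + card Z"
    using card_X by (simp add: card_configs)
  have finP: "finite P" "finite Z" using P_subset Z_subset finite_subset_X by auto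
  have "T \<subseteq> ?X" "(\<lambda>x. f (f x)) ` T \<subseteq> Z" using P_subset by (auto simp: T_def)
  then have "card T \<le> card Z" using card_ff card_mono[OF finP(2)] by metis
  \<comment> \<open>\<open>2 * card P = 4 * 2 ^ m - card Z\<close> is at least
    \<open>3 * 2 ^ m\<close>.\<close>
  moreover have "2 ^ m \<le> card P" using cX assms(2) by linarith
  ultimately obtain PH where PH: "T \<subseteq> PH" "PH \<subseteq> P" "card PH = 2 ^ m"
    using exists_subset_between[of T "2 ^ m" P] assms(2) finP by (auto simp: T_def)
  obtain s where s: "card Z = 2 * s"
  proof -
    have "even (2 * card P + card Z)" unfolding cX[symmetric] by simp
    then show ?thesis using that by (auto elim: evenE)
  qed
  obtain ZA where ZA: "ZA \<subseteq> Z" "card ZA = s"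
    using obtain_subset_with_card_n[of s Z] s by auto
  define ZB where "ZB = Z - ZA"
  have ZAB: "Z = ZA \<union> ZB" "ZA \<inter> ZB = {}" "card ZA = card ZB"
    using ZA s finP finite_subset[OF ZA(1)] by (auto simp: ZB_def card_Diff_subset)
  have cPH: "card ?X = 4 * card PH" by (simp add: card_configs PH)
  have late: "f (f x) \<notin> ZA" if "x \<in> P - PH" for x
    using that PH ZA by (auto simp: T_def)
  obtain A B St where lab: "?X = PH \<union> f ` PH \<union> A \<union> B"
    "PH \<inter> f ` PH = {}" "PH \<inter> A = {}" "PH \<inter> B = {}" "f ` PH \<inter> A = {}" "f ` PH \<inter> B = {}" "A \<inter> B = {}"
    and cAB: "card A = card PH" "card B = card PH" and ZAB': "ZA \<subseteq> A" "ZB \<subseteq> B"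
    and fA: "\<forall>x\<in>A. f x \<in> PH \<union> B" and fB': "\<forall>x\<in>B - St. f x \<in> PH \<union> A"
    and St: "St \<subseteq> B" "St \<subseteq> f ` {x \<in> P - PH. f (f x) \<in> Z}"
    by (rule labelling[OF PH(2) ZAB cPH late])
  have "St = {}" using St(2) PH(1) by (auto simp: T_def)
  then have fB: "f x \<in> PH \<union> A" if "x \<in> B" for x using fB' that by simp
  have sX: "PH \<subseteq> ?X" "A \<subseteq> ?X" "B \<subseteq> ?X" unfolding lab(1) by auto
  \<comment> \<open>Elements of \<open>N\<close> lead to layer 11 and have no descent to layer 00.
    As \<open>f\<close> sends them injectively into \<open>PH\<close>, a common
    \<open>\<phi>\<close> can place them at distinct positions, so no position loses both
    descents.\<close>
  define N where "N = {x \<in> A \<union> B. f x \<in> PH}"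
  have NX: "N \<subseteq> ?X" using sX by (auto simp: N_def)
  have "card N = card (f ` N)" using card_f[OF NX] by simp
  also have "\<dots> \<le> card PH" using sX(1) by (intro card_mono finite_subset_X) (auto simp: N_def)
  finally have "card N \<le> card (configs m)" by (simp add: card_configs PH)
  then obtain \<phi> where \<phi>: "inj_on \<phi> N" "\<phi> ` N \<subseteq> configs m"
    using inj_on_iff_card_le[OF finite_subset_X[OF NX] finite_configs] by blast
  obtain \<rho>A where \<rho>A: "bij_betw \<rho>A A (configs m)" "\<And>x. x \<in> N \<inter> A \<Longrightarrow> \<rho>A x = \<phi> x"
    by (rule extend_to_bij[of A "configs m" "N \<inter> A" \<phi>])
      (use \<phi> cAB PH sX finite_subset_X in \<open>auto simp: card_configs intro: inj_on_subset\<close>)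
  obtain \<rho>B where \<rho>B: "bij_betw \<rho>B B (configs m)" "\<And>x. x \<in> N \<inter> B \<Longrightarrow> \<rho>B x = \<phi> x"
    by (rule extend_to_bij[of B "configs m" "N \<inter> B" \<phi>])
      (use \<phi> cAB PH sX finite_subset_X in \<open>auto simp: card_configs intro: inj_on_subset\<close>)
  obtain \<rho>H where \<rho>H: "bij_betw \<rho>H PH (configs m)"
    using finite_same_card_bij[of PH "configs m"] sX PH finite_subset_X by (auto simp: card_configs)
  obtain g h where h: "h \<in> F (m + 2)" "sim (m + 2) h f"
    and g: "\<forall>x\<in>PH. g x = True # True # \<rho>H x"
      "\<forall>x\<in>PH. g (f x) = False # False # map Not (\<rho>H x)"
      "\<forall>x\<in>A. g x = False # True # \<rho>A x" "\<forall>x\<in>B. g x = True # False # \<rho>B x"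
    and hg': "\<forall>x\<in>?X. h (g x) = g (f x)"
    by (rule layered_realization[OF bij lab \<rho>H \<rho>A(1) \<rho>B(1)])
  note gH = bspec[OF g(1)] and gL = bspec[OF g(2)] and gA = bspec[OF g(3)] and gB = bspec[OF g(4)]
    and hg = bspec[OF hg']
  have exH: "\<exists>x\<in>PH. \<rho>H x = r" and exA: "\<exists>x\<in>A. \<rho>A x = r" and exB: "\<exists>x\<in>B. \<rho>B x = r"
    if "length r = m" for r
  proof -
    have "r \<in> configs m" using that by (simp add: configs_def)
    then show "\<exists>x\<in>PH. \<rho>H x = r" "\<exists>x\<in>A. \<rho>A x = r" "\<exists>x\<in>B. \<rho>B x = r"
      using \<rho>H \<rho>A(1) \<rho>B(1) unfolding bij_betw_def by (metis imageE)+
  qed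
  have "reach_within (parcs (async_graph (m + 2) h)) (hamming_dist x y + 4) x y"
    if "x \<in> ?X" "y \<in> ?X" for x y
  proof (rule reach_via_one_layer[OF _ _ _ _ _ that])
    fix r :: "bool list" assume r: "length r = m"
    obtain u where u: "u \<in> PH" "\<rho>H u = r" using exH[OF r] by blast
    show "h (True # True # r) = False # False # map Not r"
      using hg[of u] u gH gL sX by auto
    obtain a where a: "a \<in> A" "\<rho>A a = r" using exA[OF r] by blast
    obtain b where b: "b \<in> B" "\<rho>B b = r" using exB[OF r] by blast
    have ha: "h (False # True # r) = g (f a)" using hg[of a] gA[OF a(1)] a sX by auto
    have hb: "h (True # False # r) = g (f b)" using hg[of b] gB[OF b(1)] b sX by auto
    show "h (False # True # r) ! 0" using bspec[OF fA a(1)] gH gB ha by auto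
    show "h (True # False # r) ! 1" using fB[OF b(1)] gH gA hb by auto
    obtain v where v: "v \<in> PH" "\<rho>H v = map Not r" using exH[of "map Not r"] r by auto
    have vX: "v \<in> ?X" using sX(1) v(1) by (rule subsetD)
    have fv: "v \<in> ?X" "f v \<in> ?X" "f v \<notin> PH"
      using vX f_in_X[OF vX] lab(2) v(1) by auto
    \<comment> \<open>The successor of an element of layer 00 is not in layer 00, hence has a 1
      among its first two components.\<close>
    have "f (f v) \<notin> f ` PH" using fv f_inj sX(1) by (metis imageE subsetD)
    moreover have "f (f v) \<in> PH \<union> f ` PH \<union> A \<union> B"
      using f_in_X[OF fv(2)] unfolding lab(1) .
    ultimately have "f (f v) \<in> PH \<union> A \<union> B" by simp
    moreover have "h (False # False # r) = g (f (f v))"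
      using hg[OF fv(2)] gL[OF v(1)] v(2) by (simp add: comp_def del: add_2_eq_Suc')
    ultimately show "h (False # False # r) ! 0 \<or> h (False # False # r) ! 1"
      using gH gA gB by auto
    show "\<not> h (False # True # r) ! 1 \<or> \<not> h (True # False # r) ! 0"
    proof (cases "a \<in> N")
      case True
      have "b \<notin> N"
      proof
        assume "b \<in> N"
        then have "\<phi> a = \<phi> b" using True a b \<rho>A(2) \<rho>B(2) by auto
        then show False using \<phi>(1) True \<open>b \<in> N\<close> a b lab(7) by (auto dest: inj_onD)
      qed
      then have "f b \<in> A" using fB[OF b(1)] b by (auto simp: N_def)
      then show ?thesis using gA hb by simp
    next
      case False
      then have "f a \<in> B" using bspec[OF fA a(1)] a by (auto simp: N_def)
      then show ?thesis using gB ha by simp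
    qed
  qed
  with h show ?thesis by blast
qed

text \<open>Alternation may now fail at \<open>St\<close>, but \<open>PH\<close> can be chosen so
  that \<open>f (f x)\<close> is unpaired for all its elements; their positions can then be adjusted
  to make layer 00 free.\<close>

lemma many_unpaired:
  assumes "paired_derangement (configs (m + 2)) f P Z" "card Z > 2 ^ m"
  shows "\<exists>h \<in> F (m + 2). sim (m + 2) h f \<and> (\<forall>x \<in> configs (m + 2). \<forall>y \<in> configs (m + 2).
    reach_within (parcs (async_graph (m + 2) h)) (hamming_dist x y + 4) x y)"
proof -
  interpret paired_derangement "configs (m + 2)" f P Z by fact
  let ?X = "configs (m + 2)" and ?ff = "\<lambda>x. f (f x)"
  define T where "T = {x \<in> P. f (f x) \<in> Z}"
  have cX: "4 * 2 ^ m = 2 * card P + card Z"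
    using card_X by (simp add: card_configs)
  have m: "m > 0"
  \<comment> \<open>For \<open>m = 0\<close> the equation \<open>2 * card P + card Z = 4\<close>
    contradicts \<open>1 < card Z \<le> card P\<close>.\<close>
  proof (rule ccontr)
    assume "\<not> m > 0"
    then show False using cX card_Z_le assms(2) by simp
  qed
  have finP: "finite P" "finite Z" using P_subset Z_subset finite_subset_X by auto
  have TX: "T \<subseteq> ?X" using P_subset by (auto simp: T_def)
  have "?ff ` T = Z" using Z_preimage by (auto simp: T_def)
  then have "card T = card Z" using card_ff[OF TX] by simp
  then obtain PH where PH: "PH \<subseteq> T" "card PH = 2 ^ m"
    using obtain_subset_with_card_n[of "2 ^ m" T] assms(2) by auto
  have PHP: "PH \<subseteq> P" using PH by (auto simp: T_def)
  have PHX: "PH \<subseteq> ?X" using PH TX by blast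
  \<comment> \<open>\<open>ZH\<close> is the set of successors of layer 00.\<close>
  define ZH where "ZH = ?ff ` PH"
  have ZH: "ZH \<subseteq> Z" using PH by (auto simp: ZH_def T_def)
  have cZH: "card ZH = 2 ^ m" using card_ff[OF PHX] PH by (simp add: ZH_def)
  have ff_inj: "f (f x) = f (f y) \<longleftrightarrow> x = y" if "x \<in> ?X" "y \<in> ?X" for x y
    using that f_inj f_in_X by metis
  have ff_ZH: "f (f x) \<in> ZH \<longleftrightarrow> x \<in> PH" if "x \<in> ?X" for x
  proof
    assume "f (f x) \<in> ZH"
    then obtain y where "y \<in> PH" "f (f x) = f (f y)" unfolding ZH_def by (rule imageE)
    then show "x \<in> PH" using ff_inj[OF that subsetD[OF PHX]] by simp
  qed (simp add: ZH_def)
  obtain s where s: "card Z = 2 * s"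
  proof -
    have "even (2 * card P + card Z)" unfolding cX[symmetric] by simp
    then show ?thesis using that by (auto elim: evenE)
  qed
  \<comment> \<open>\<open>3 * card Z \<le> 4 * 2 ^ m\<close>, so half of \<open>Z\<close> fits into
    \<open>ZH\<close>. Choosing \<open>ZA\<close> there yields \<open>late\<close>, since only
    \<open>PH\<close> reaches \<open>ZH\<close> under \<open>f \<circ> f\<close>.\<close>
  have "s \<le> card ZH" using cZH cX card_Z_le s by linarith
  then obtain ZA where ZA: "ZA \<subseteq> ZH" "card ZA = s"
    using obtain_subset_with_card_n[of s ZH] by metis
  define ZB where "ZB = Z - ZA"
  have ZAZ: "ZA \<subseteq> Z" using ZA ZH by blast
  have ZAB: "Z = ZA \<union> ZB" "ZA \<inter> ZB = {}" "card ZA = card ZB"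
    using ZAZ ZA s finP finite_subset[OF ZAZ] by (auto simp: ZB_def card_Diff_subset)
  have cPH: "card ?X = 4 * card PH" by (simp add: card_configs PH)
  have late: "f (f x) \<notin> ZA" if "x \<in> P - PH" for x
  proof -
    have "x \<in> ?X" "x \<notin> PH" using that P_subset by blast+
    then show ?thesis using ff_ZH ZA by blast
  qed
  obtain A B St where lab: "?X = PH \<union> f ` PH \<union> A \<union> B"
    "PH \<inter> f ` PH = {}" "PH \<inter> A = {}" "PH \<inter> B = {}" "f ` PH \<inter> A = {}" "f ` PH \<inter> B = {}" "A \<inter> B = {}"
    and cAB: "card A = card PH" "card B = card PH" and ZAB': "ZA \<subseteq> A" "ZB \<subseteq> B"
    and fA: "\<forall>x\<in>A. f x \<in> PH \<union> B" and fB: "\<forall>x\<in>B - St. f x \<in> PH \<union> A"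
    and St: "St \<subseteq> B" "St \<subseteq> f ` {x \<in> P - PH. f (f x) \<in> Z}"
    by (rule labelling[OF PHP ZAB cPH late])
  have sX: "PH \<subseteq> ?X" "A \<subseteq> ?X" "B \<subseteq> ?X" unfolding lab(1) by auto
  have finS: "finite S" if "S \<subseteq> ?X" for S using that by (rule finite_subset_X)
  \<comment> \<open>Every \<open>r\<close> carries exactly one element of \<open>Q\<close>, in layer 01 or 10, and in the other of these two
    layers the successor of the element of layer 00 at \<open>map Not r\<close>. The elements of \<open>Q\<close> that do not
    lead to layer 00 are placed at first component 0, and each stuck element opposite its image.\<close>
  define Q where "Q = (A \<union> B) - ZH"
  have ZHAB: "ZH \<subseteq> A \<union> B" using ZH ZAB(1) ZAB' by blast
  have QX: "Q \<subseteq> ?X" using sX by (auto simp: Q_def)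
  have "card (A \<union> B) = 2 * 2 ^ m"
    using card_Un_disjoint[of A B] finS sX lab(7) cAB PH by simp
  then have cQ: "card Q = card (configs m)"
    using ZHAB cZH finite_subset[OF ZH finP(2)] by (simp add: Q_def card_Diff_subset card_configs)
  have StP: "\<exists>x. y = f x \<and> x \<in> P \<and> x \<notin> PH \<and> f y \<in> Z" if "y \<in> St" for y
    using St(2) that by blast
  have St_notZ: "y \<notin> Z" if "y \<in> St" for y
    using StP[OF that] Z_disj(2) by blast
  have StX: "St \<subseteq> ?X" using St(1) sX by blast
  have StQ: "St \<subseteq> Q" using St(1) St_notZ ZH by (auto simp: Q_def)
  have fSt: "f y \<in> ZB" "f y \<notin> ZH" "f y \<in> Q" "f (f y) \<notin> PH" "f y \<notin> St" if y: "y \<in> St" for y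
  proof -
    obtain x where x: "y = f x" "x \<in> P" "x \<notin> PH" "f y \<in> Z" using StP[OF y] by blast
    have xX: "x \<in> ?X" using x P_subset by blast
    show nZH: "f y \<notin> ZH" using ff_ZH[OF xX] x by simp
    show zb: "f y \<in> ZB" using nZH ZA(1) x(4) by (auto simp: ZB_def)
    show "f y \<in> Q" using nZH zb ZAB' by (auto simp: Q_def)
    show "f y \<notin> St" using St_notZ x(4) by blast
    \<comment> \<open>Otherwise \<open>Z_chain\<close> would put \<open>f y\<close> on a 3-cycle
      through \<open>PH\<close>, hence into \<open>ZH\<close>. So the image of a stuck element is
      itself no defect and may sit at first component 1.\<close>
    show "f (f y) \<notin> PH"
    proof
      assume a: "f (f y) \<in> PH"
      then have "f (f (f (f y))) \<in> Z" using PH by (auto simp: T_def)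
      then have "f (f (f (f y))) = f y" using Z_chain x(4) by blast
      then have "f y \<in> ZH" using a by (metis ZH_def imageI)
      with nZH show False by blast
    qed
  qed

  define N where "N = {q \<in> Q. f q \<in> PH}"
  define PM where "PM = P - PH"
  define T' where "T' = {x \<in> PM. f (f x) \<in> Z}"
  have NX: "N \<subseteq> ?X" using QX by (auto simp: N_def)
  \<comment> \<open>\<open>N\<close> and \<open>ZP\<close> together inject into \<open>PH\<close>,
    so \<open>card N \<le> card ZM\<close>; \<open>St\<close> lies in the image of
    \<open>T'\<close>; and \<open>Z_chain\<close> makes \<open>T'\<close> disjoint from the image of
    \<open>ZM\<close> inside \<open>PM\<close>.\<close>
  have "card N + card St \<le> card PM"
  proof -
    define ZP where "ZP = {z \<in> ZH. f z \<in> PH}"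
    define ZM where "ZM = {z \<in> ZH. f z \<in> PM}"
    have ZX: "ZH \<subseteq> ?X" using ZH Z_subset by blast
    have ZPX: "ZP \<subseteq> ?X" and ZMX: "ZM \<subseteq> ?X" using ZX by (auto simp: ZP_def ZM_def)
    have "ZH = ZP \<union> ZM" using f_Z ZH by (auto simp: ZP_def ZM_def PM_def)
    moreover have "ZP \<inter> ZM = {}" by (auto simp: ZP_def ZM_def PM_def)
    ultimately have 1: "card ZP + card ZM = 2 ^ m"
      using card_Un_disjoint[of ZP ZM] finS ZPX ZMX cZH by simp
    have "N \<inter> ZP = {}" by (auto simp: N_def ZP_def Q_def)
    then have "card N + card ZP = card (N \<union> ZP)"
      using card_Un_disjoint[of N ZP] finS ZPX NX by simp
    also have "\<dots> = card (f ` (N \<union> ZP))" using card_f[of "N \<union> ZP"] NX ZPX by simp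
    also have "\<dots> \<le> card PH" by (intro card_mono finS sX) (auto simp: N_def ZP_def)
    finally have 2: "card N \<le> card ZM" using 1 PH(2) by simp
    have T'X: "T' \<subseteq> ?X" using P_subset by (auto simp: T'_def PM_def)
    have "card St \<le> card (f ` T')"
      by (intro card_mono finite_imageI finS T'X) (use St(2) in \<open>auto simp: T'_def PM_def\<close>)
    then have 3: "card St \<le> card T'" using card_f[OF T'X] by simp
    have "f ` ZM \<inter> T' = {}"
    proof -
      have False if "z \<in> ZM" "f z \<in> T'" for z
      proof -
        have z: "z \<in> ZH" "z \<in> Z" "f (f (f z)) \<in> Z" "f z \<in> P" "f z \<notin> PH"
          using that ZH by (auto simp: ZM_def T'_def PM_def)
        have "f (f (f z)) \<in> ZH" using Z_chain[OF z(2,3)] z(1) by metis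
        then show False using ff_ZH[of "f z"] z P_subset by blast
      qed
      then show ?thesis by blast
    qed
    then have "card ZM + card T' = card (f ` ZM \<union> T')"
      using card_Un_disjoint[of "f ` ZM" T'] card_f[OF ZMX] finS ZMX T'X by simp
    also have "\<dots> \<le> card PM"
      by (intro card_mono) (use finP in \<open>auto simp: ZM_def T'_def PM_def\<close>)
    finally show ?thesis using 2 3 by simp
  qed
  moreover have "card PM + 2 ^ m = card P"
    using PHP PH(2) finP finite_subset[OF PHP] card_mono[OF finP(1) PHP]
    by (simp add: PM_def card_Diff_subset)
  \<comment> \<open>\<open>card PM = card P - 2 ^ m\<close> and
    \<open>2 * card P < 3 * 2 ^ m\<close>, so the defects fit into \<open>R0\<close>, the half of
    the positions with first component 0.\<close>
  ultimately have small: "2 * card (N \<union> St) \<le> 2 ^ m"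
    using card_Un_le[of N St] cX assms(2) by linarith
  define NC where "NC = N \<union> St"
  have NCQ: "NC \<subseteq> Q" using StQ by (auto simp: NC_def N_def)
  define R0 where "R0 = (#) False ` configs (m - 1)"
  have "2 * card R0 = 2 ^ m"
    using m by (simp add: R0_def card_image card_configs flip: power_Suc)
  then have "card NC \<le> card R0" using small by (simp add: NC_def)
  moreover have "finite NC" using finS NCQ QX by blast
  ultimately obtain \<phi> where \<phi>: "inj_on \<phi> NC" "\<phi> ` NC \<subseteq> R0"
    using inj_on_iff_card_le[of NC R0] by (auto simp: R0_def)
  have R0: "r \<in> configs m" "\<not> r ! 0" "map Not r ! 0" "map Not r \<in> configs m" if "r \<in> R0" for r
    using that m by (auto simp: R0_def configs_def)
  have mapNot: "map Not r = map Not r' \<longleftrightarrow> r = r'" for r r'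
    by (auto simp: map_injective inj_def)

  \<comment> \<open>The images of stuck elements get complementary positions; these have first
    component 1 and cannot collide with \<open>R0\<close>.\<close>
  define \<phi>' where "\<phi>' x = (if x \<in> NC then \<phi> x else map Not (\<phi> (inv_into ?X f x)))" for x
  have \<phi>'_f: "\<phi>' (f y) = map Not (\<phi> y)" "f y \<notin> NC" if y: "y \<in> St" for y
  proof -
    show nc: "f y \<notin> NC" using fSt[OF y] by (auto simp: NC_def N_def)
    have "inv_into ?X f (f y) = y" using bij y StX by (meson bij_betw_inv_into_left subsetD)
    then show "\<phi>' (f y) = map Not (\<phi> y)" using nc by (simp add: \<phi>'_def)
  qed
  have \<phi>'_NC: "\<phi>' x = \<phi> x" if "x \<in> NC" for x using that by (simp add: \<phi>'_def)
  have \<phi>R: "\<phi> x \<in> R0" if "x \<in> NC" for x using \<phi>(2) that by blast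
  have StNC: "y \<in> NC" if "y \<in> St" for y using that by (simp add: NC_def)
  have inj\<phi>': "inj_on \<phi>' (NC \<union> f ` St)"
  proof -
    have "inj_on \<phi>' NC" using \<phi>(1) \<phi>'_NC by (simp add: inj_on_def)
    moreover have "inj_on \<phi>' (f ` St)"
    proof (rule inj_onI)
      fix u v assume "u \<in> f ` St" "v \<in> f ` St" and eq: "\<phi>' u = \<phi>' v"
      then obtain y y' where y: "y \<in> St" "u = f y" "y' \<in> St" "v = f y'" by blast
      then have "\<phi> y = \<phi> y'" using eq \<phi>'_f(1) mapNot by simp
      then show "u = v" using y \<phi>(1) StNC by (auto dest: inj_onD)
    qed
    moreover have "\<phi>' u \<noteq> \<phi>' v" if u: "u \<in> NC" and v: "v \<in> f ` St" for u v
    proof -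
      obtain y where y: "y \<in> St" "v = f y" using v by blast
      have "\<not> \<phi>' u ! 0" using R0(2) \<phi>R \<phi>'_NC u by simp
      moreover have "\<phi>' v ! 0" using R0(3) \<phi>R StNC y \<phi>'_f(1) by simp
      ultimately show ?thesis by metis
    qed
    ultimately show ?thesis unfolding inj_on_def by (metis UnE)
  qed
  have "\<phi>' ` (NC \<union> f ` St) \<subseteq> configs m"
  proof
    fix r assume "r \<in> \<phi>' ` (NC \<union> f ` St)"
    then consider x where "x \<in> NC" "r = \<phi>' x" | y where "y \<in> St" "r = \<phi>' (f y)" by blast
    then show "r \<in> configs m"
      by cases (use R0(1,4) \<phi>R StNC \<phi>'_NC \<phi>'_f(1) in auto)
  qed
  moreover have "NC \<union> f ` St \<subseteq> Q" using NCQ fSt(3) by blast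
  ultimately obtain \<rho> where \<rho>: "bij_betw \<rho> Q (configs m)" "\<And>x. x \<in> NC \<union> f ` St \<Longrightarrow> \<rho> x = \<phi>' x"
    using extend_to_bij[OF finS[OF QX] finite_configs cQ _ inj\<phi>'] by metis
  have \<rho>NC: "\<not> \<rho> x ! 0" if "x \<in> NC" for x
    using \<rho>(2)[of x] \<phi>'_NC[OF that] R0(2)[OF \<phi>R[OF that]] that by simp
  have \<rho>St: "\<rho> (f y) = map Not (\<rho> y)" if "y \<in> St" for y
    using \<rho>(2)[of y] \<rho>(2)[of "f y"] \<phi>'_NC[OF StNC[OF that]] \<phi>'_f(1)[OF that] that StNC by simp
  have inj\<rho>: "inj_on \<rho> Q" and ran\<rho>: "\<rho> ` Q = configs m" using \<rho>(1) by (auto simp: bij_betw_def)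
  have sub: "\<rho> ` (Q \<inter> S) \<subseteq> configs m" "inj_on \<rho> (Q \<inter> S)" for S
    using inj\<rho> ran\<rho> by (auto intro: inj_on_subset)
  have cA: "card A = card (configs m)" "card B = card (configs m)"
    using cAB PH by (auto simp: card_configs)
  obtain \<rho>A where \<rho>A: "bij_betw \<rho>A A (configs m)" "\<And>x. x \<in> Q \<inter> A \<Longrightarrow> \<rho>A x = \<rho> x"
    using extend_to_bij[OF finS[OF sX(2)] finite_configs cA(1) _ sub(2,1)[of A]] by blast
  obtain \<rho>B where \<rho>B: "bij_betw \<rho>B B (configs m)" "\<And>x. x \<in> Q \<inter> B \<Longrightarrow> \<rho>B x = \<rho> x"
    using extend_to_bij[OF finS[OF sX(3)] finite_configs cA(2) _ sub(2,1)[of B]] by blast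
  \<comment> \<open>\<open>x\<close> gets the position of \<open>f (f x)\<close>. As
    \<open>f x\<close> lies in layer 00 at the complementary position, its successor is opposite to
    it in the last \<open>m\<close> components.\<close>
  define \<rho>H where "\<rho>H x = (if f (f x) \<in> ZA then \<rho>A (f (f x)) else \<rho>B (f (f x)))" for x
  have QAB: "q \<in> A \<or> q \<in> B" "q \<notin> ZH" if "q \<in> Q" for q using that by (auto simp: Q_def)
  have ZH_B: "z \<in> B" "z \<in> ZB" if "z \<in> ZH" "z \<notin> ZA" for z using that ZH ZAB' by (auto simp: ZB_def)
  have AB: "x \<notin> B" if "x \<in> A" for x using that lab(7) by auto
  have ffPH: "f (f x) \<in> ZH" if "x \<in> PH" for x using that by (simp add: ZH_def)
  have \<rho>H: "bij_betw \<rho>H PH (configs m)"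
  proof -
    have into: "\<rho>H x \<in> configs m" if "x \<in> PH" for x
      using bij_betwE[OF \<rho>A(1)] bij_betwE[OF \<rho>B(1)] ZH_B(1)[OF ffPH[OF that]] subsetD[OF ZAB'(1)]
      by (simp add: \<rho>H_def)
    \<comment> \<open>Of layers 01 and 10, the one without the element of \<open>Q\<close> at
      \<open>r\<close> has an element of \<open>ZH\<close> there.\<close>
    have onto: "\<exists>x\<in>PH. \<rho>H x = r" if r: "r \<in> configs m" for r
    proof -
      obtain q where q: "q \<in> Q" "\<rho> q = r" using \<rho>(1) r by (rule bij_betw_preimage)
      show ?thesis
      proof (cases "q \<in> A")
        case True
        obtain b where b: "b \<in> B" "\<rho>B b = r" using \<rho>B(1) r by (rule bij_betw_preimage)
        have "b \<notin> Q"
        proof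
          assume "b \<in> Q"
          then have "b = q" using \<rho>B(2)[of b] b q inj\<rho> by (auto dest: inj_onD)
          then show False using AB[OF True] b by simp
        qed
        then have "b \<in> ZH" using b by (simp add: Q_def)
        moreover have "b \<notin> ZA" using b AB ZAB' by blast
        ultimately show ?thesis using b by (auto simp: ZH_def \<rho>H_def)
      next
        case False
        then have qB: "q \<in> B" using QAB q by blast
        obtain a where a: "a \<in> A" "\<rho>A a = r" using \<rho>A(1) r by (rule bij_betw_preimage)
        have "a \<notin> Q"
        proof
          assume "a \<in> Q"
          then have "a = q" using \<rho>A(2)[of a] a q inj\<rho> by (auto dest: inj_onD)
          then show False using False a by simp
        qed
        then have "a \<in> ZH" using a by (simp add: Q_def)
        moreover have "a \<in> ZA" using a AB ZH_B(1) \<open>a \<in> ZH\<close> by blast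
        ultimately show ?thesis using a by (auto simp: ZH_def \<rho>H_def)
      qed
    qed
    have img: "\<rho>H ` PH = configs m" using into onto by auto
    then have "inj_on \<rho>H PH"
      by (intro eq_card_imp_inj_on finS sX) (simp add: PH card_configs)
    with img show ?thesis by (simp add: bij_betw_def)
  qed
  obtain g h where h: "h \<in> F (m + 2)" "sim (m + 2) h f"
    and g: "\<forall>x\<in>PH. g x = True # True # \<rho>H x"
      "\<forall>x\<in>PH. g (f x) = False # False # map Not (\<rho>H x)"
      "\<forall>x\<in>A. g x = False # True # \<rho>A x" "\<forall>x\<in>B. g x = True # False # \<rho>B x"
    and hg': "\<forall>x\<in>?X. h (g x) = g (f x)"
    by (rule layered_realization[OF bij lab \<rho>H \<rho>A(1) \<rho>B(1)])
  note gH = bspec[OF g(1)] and gL = bspec[OF g(2)] and gA = bspec[OF g(3)] and gB = bspec[OF g(4)]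
    and hg = bspec[OF hg']
  have exH: "\<exists>x\<in>PH. \<rho>H x = r" and exA: "\<exists>x\<in>A. \<rho>A x = r" and exB: "\<exists>x\<in>B. \<rho>B x = r"
    and exQ: "\<exists>x\<in>Q. \<rho> x = r" if "length r = m" for r
  proof -
    have "r \<in> configs m" using that by (simp add: configs_def)
    then show "\<exists>x\<in>PH. \<rho>H x = r" "\<exists>x\<in>A. \<rho>A x = r" "\<exists>x\<in>B. \<rho>B x = r" "\<exists>x\<in>Q. \<rho> x = r"
      using \<rho>H \<rho>A(1) \<rho>B(1) \<rho>(1) unfolding bij_betw_def by (metis imageE)+
  qed
  have hA: "h (False # True # \<rho>A a) = g (f a)" if "a \<in> A" for a
    using hg[OF subsetD[OF sX(2) that]] gA[OF that] by simp
  have hB: "h (True # False # \<rho>B b) = g (f b)" if "b \<in> B" for b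
    using hg[OF subsetD[OF sX(3) that]] gB[OF that] by simp
  have hL: "h (False # False # map Not (\<rho>H x)) = g (f (f x))" if "x \<in> PH" for x
    using hg[OF f_in_X[OF subsetD[OF sX(1) that]]] gL[OF that] by simp
  have hB1: "h (True # False # \<rho>B b) ! 1" if "b \<in> B" "b \<notin> St" for b
    using bspec[OF fB, of b] that gH gA hB by auto
  have hSt: "\<not> \<rho>B y ! 0" "\<rho>B (f y) = map Not (\<rho>B y)" "f y \<in> B" if y: "y \<in> St" for y
  proof -
    have yB: "y \<in> Q \<inter> B" "f y \<in> Q \<inter> B" using y StQ St(1) fSt(1,3)[OF y] ZAB'(2) by blast+
    then show "\<not> \<rho>B y ! 0" "\<rho>B (f y) = map Not (\<rho>B y)" "f y \<in> B"
      using \<rho>B(2)[OF yB(1)] \<rho>B(2)[OF yB(2)] \<rho>NC[OF StNC[OF y]] \<rho>St[OF y] by auto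
  qed
  have "reach_within (parcs (async_graph (m + 2) h)) (hamming_dist x y + 4) x y"
    if "x \<in> ?X" "y \<in> ?X" for x y
  proof (rule reach_via_two_layers[OF _ _ _ _ _ _ _ m that])
    fix r :: "bool list" assume r: "length r = m"
    obtain u where u: "u \<in> PH" "\<rho>H u = r" using exH[OF r] by blast
    show "h (True # True # r) = False # False # map Not r"
      using hg[OF subsetD[OF sX(1) u(1)]] u gH gL by simp
    obtain v where v: "v \<in> PH" "\<rho>H v = map Not r" using exH[of "map Not r"] r by auto
    have hv: "h (False # False # r) = g (f (f v))" using hL[OF v(1)] v(2) by (simp add: comp_def)
    have gv: "g (f (f v)) = (if f (f v) \<in> ZA then False # True # map Not r else True # False # map Not r)"
      using v gA[of "f (f v)"] gB[of "f (f v)"] ZAB'(1) ZH_B(1) ffPH[OF v(1)]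
      by (auto simp: \<rho>H_def split: if_splits)
    show "\<exists>a b. h (False # False # r) = a # b # map Not r" using hv gv by auto
    obtain a where a: "a \<in> A" "\<rho>A a = r" using exA[OF r] by blast
    show "h (False # True # r) ! 0" using bspec[OF fA a(1)] gH gB hA[OF a(1)] a(2) by auto
    obtain b where b: "b \<in> B" "\<rho>B b = r" using exB[OF r] by blast
    have stuck: "\<not> r ! 0 \<and> h (True # False # r) ! 2" if "b \<in> St"
      using hSt[OF that] hB[OF b(1)] b(2) gB[OF hSt(3)[OF that]] r m by (simp add: numeral_2_eq_2)
    show "h (True # False # r) ! 1 \<or> \<not> r ! 0 \<and> h (True # False # r) ! 2"
      using stuck hB1[OF b(1)] b(2) by blast
    show "h (True # False # r) ! 1" if "r ! 0"
      using stuck hB1[OF b(1)] b(2) that by blast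
    show "h (False # False # r) ! 1 \<or> h (False # False # r) ! 0 \<and> h (True # False # r) ! 1"
    proof (cases "f (f v) \<in> ZA")
      case True
      then show ?thesis using hv gv by simp
    next
      case False
      \<comment> \<open>Otherwise \<open>f b\<close> and \<open>f (f v)\<close> would share the
        position \<open>map Not r\<close> of layer 10 and coincide, although only the latter is in
        \<open>ZH\<close>.\<close>
      have "b \<notin> St"
      proof
        assume bS: "b \<in> St"
        have "\<rho>B (f b) = \<rho>B (f (f v))" using hSt(2)[OF bS] b v False by (simp add: \<rho>H_def)
        then have "f b = f (f v)"
          using \<rho>B(1) hSt(3)[OF bS] ZH_B(1)[OF ffPH[OF v(1)] False]
          by (auto simp: bij_betw_def dest: inj_onD)
        then show False using fSt(2)[OF bS] ffPH[OF v(1)] by simp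
      qed
      then show ?thesis using hv gv False hB1[OF b(1)] b(2) by simp
    qed
    show "\<not> h (False # True # r) ! 1 \<or> \<not> h (True # False # r) ! 0" if r0: "r ! 0"
    proof -
      obtain q where q: "q \<in> Q" "\<rho> q = r" using exQ[OF r] by blast
      \<comment> \<open>Defects sit at first component 0, so \<open>q\<close> leads from layer 01 to
        10 or conversely, which gives the arc to layer 00.\<close>
      have nq: "f q \<notin> PH" "q \<notin> St" using \<rho>NC[of q] q r0 by (auto simp: NC_def N_def)
      show ?thesis
      proof (cases "q \<in> A")
        case True
        then have "f q \<in> B" using bspec[OF fA True] nq by blast
        then show ?thesis using hA[OF True] \<rho>A(2)[of q] True q gB by simp
      next
        case False
        then have qB: "q \<in> B" using QAB q by blast
        then have "f q \<in> A" using bspec[OF fB, of q] nq by blast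
        then show ?thesis using hB[OF qB] \<rho>B(2)[of q] qB q gA by simp
      qed
    qed
  qed
  with h show ?thesis by blast
qed

section \<open>Dimensions 0, 1 and at least 2\<close>

theorem theorem9:
  fixes n :: nat and f :: "bool list \<Rightarrow> bool list"
  assumes "f \<in> F n" and "derangement n f"
  shows "\<exists>h \<in> F n. sim n h f \<and>
    (\<forall>x \<in> configs n. \<forall>y \<in> configs n.
      \<exists>p. pre_digraph.apath (with_proj (async_graph n h)) x p y \<and>
          length p \<le> hamming_dist x y + 4)"
proof -
  have bij: "bij_betw f (configs n) (configs n)" and nofix: "\<And>x. x \<in> configs n \<Longrightarrow> f x \<noteq> x"
    using assms(2) by (auto simp: derangement_def)
  consider "n = 0" | "n = 1" | m where "n = m + 2"
    by (metis One_nat_def add_2_eq_Suc' not0_implies_Suc)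
  then have "\<exists>h \<in> F n. sim n h f \<and> (\<forall>x \<in> configs n. \<forall>y \<in> configs n.
    reach_within (parcs (async_graph n h)) (hamming_dist x y + 4) x y)"
  proof cases
    case 1
    \<comment> \<open>The only configuration would be a fixed point, so this case is void.\<close>
    have "f [] \<in> configs 0" "f [] \<noteq> []"
      using assms(1) nofix[of "[]"] 1 by (auto simp: F_def configs_def)
    then show ?thesis by (simp add: configs_def)
  next
    case 2
    \<comment> \<open>In dimension 1 a derangement is negation, and \<open>h = f\<close>
      works.\<close>
    have "sim n f f" by (rule simI[of f n id]) (use assms(1) in auto)
    moreover have "reach_within (parcs (async_graph n f)) (hamming_dist x y + 4) x y"
      if xy: "x \<in> configs n" "y \<in> configs n" for x y
    proof (cases "x = y")
      case True
      then show ?thesis by (simp add: reach_within_refl)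
    next
      case False
      obtain a c where ac: "x = [a]" "y = [c]" using xy 2 by (auto simp: configs_def length_Suc_conv)
      have "f [a] \<in> configs n" "f [a] \<noteq> [a]" using assms(1) nofix xy ac by (auto simp: F_def)
      then have "f [a] ! 0 \<noteq> a" using 2 by (auto simp: configs_def length_Suc_conv)
      then have "([a], [\<not> a]) \<in> parcs (async_graph n f)"
        using async_arc[of "[]" a "[]" n f] 2 by simp
      moreover have "y = [\<not> a]" using False ac by auto
      ultimately have "reach_within (parcs (async_graph n f)) 1 x y"
        unfolding ac(1) by (simp only: reach_within_arc)
      then show ?thesis by (rule reach_within_mono) simp
    qed
    ultimately show ?thesis using assms(1) by blast
  next
    case (3 m)
    obtain P where "paired_derangement (configs (m + 2)) f P (configs (m + 2) - P - f ` P)"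
      using paired_derangement_exists[OF _ bij nofix] 3 by auto
    then show ?thesis
      unfolding 3 using few_unpaired many_unpaired not_le by blast
  qed
  then show ?thesis using async_reach_imp_apath by meson
qed

end
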